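(* Let $\{\alpha_n\}_{n\geq0}$ be a sequence of complex numbers with $|\alpha_n|<1$ for all $n$ satisfying \[ \lim_{j\rightarrow\infty}\frac{1}{n_j}\sum_{k=0}^{n_j-1}|\alpha_k|=r\in[0,1) \] for some sequence $\{n_j\}_{j=1}^{\infty}$ of positive integers increasing to infinity. Let $\{\beta_n\}_{n\ge 0}$ be any sequence in $\partial\mathbb{D}$, and for $n\geq 1$ let $\nu_n$ be the normalized counting measure of the arguments of the zeros of the paraorthogonal polynomial $\Phi_n^{(\beta_{n-1})}$. Suppose $\nu$ is a weak-$*$ limit (along some subsequence) of the measures $\{\nu_{n_j}\}_{j=1}^{\infty}$. Then any interval of length $\Delta\in(0,2\pi]$ has $\nu$-measure in the interval $\left[\frac{\Delta}{2\pi}-r,\frac{\Delta}{2\pi}+r\right]$. In particular, every interval of length larger than $2\pi r$ has positive $\nu$-measure.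
   Context: $\mathbb{D}$ is the open unit disk in $\mathbb{C}$ and $\partial\mathbb{D}$ is the unit circle. Given a sequence $\{\alpha_n\}_{n=0}^\infty$ in $\mathbb{D}$ (the Verblunsky coefficients), the monic orthogonal polynomials on the unit circle $\{\Phi_n\}_{n=0}^\infty$ are determined by $\Phi_0(z)=1$ and the Szeg\H{o} recursion \[ \Phi_{n+1}(z)=z\Phi_n(z)-\overline{\alpha}_n\Phi_n^*(z),\qquad \Phi_n^*(z)=z^n\overline{\Phi_n(1/\overline{z})}. \] For $\beta_n\in\partial\mathbb{D}$, the degree $n+1$ paraorthogonal polynomial is \[ \Phi_{n+1}^{(\beta_n)}(z)=z\Phi_n(z)-\overline{\beta}_n\Phi_n^*(z). \] All $n+1$ zeros of $\Phi_{n+1}^{(\beta_n)}$ lie on $\partial\mathbb{D}$ and are simple. Writing the zeros of $\Phi_n^{(\beta_{n-1})}$ as $e^{i\theta_1^{(n)}},\ldots,e^{i\theta_n^{(n)}}$ with $0\le\theta_1^{(n)}<\cdots<\theta_n^{(n)}<2\pi$, define \[ d\nu_n=\frac{1}{n}\sum_{j=1}^n\delta_{\theta_j^{(n)}}. \] Arguments are taken modulo $2\pi$: the $\nu_n$ and their weak-$*$ limits are regarded as probability measures on $\mathbb{R}/2\pi\mathbb{Z}$ (equivalently, on the unit circle), and "interval of length $\Delta$" means the image in $\mathbb{R}/2\pi\mathbb{Z}$ of an interval of length $\Delta\le 2\pi$ in $\mathbb{R}$ (an arc of angular length $\Delta$). *)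

theory Defs
  imports "HOL-Probability.Probability" "HOL-Computational_Algebra.Polynomial"
begin

text \<open>
  The reversed polynomial \<open>z ^ n * cnj (p (1 / cnj z))\<close> of a polynomial of degree at most n.
  It is given by its coefficients, because the formula itself has no value at 0;
  agreement away from 0 is lemma \<open>poly_szego_star\<close>.
\<close>
definition szego_star :: "nat \<Rightarrow> complex poly \<Rightarrow> complex poly" where
  "szego_star n p = (\<Sum>k\<le>n. monom (cnj (coeff p (n - k))) k)"

text \<open>Here \<open>[:0, 1:]\<close> is the polynomial z.\<close>
primrec opuc :: "(nat \<Rightarrow> complex) \<Rightarrow> nat \<Rightarrow> complex poly" where
  "opuc \<alpha> 0 = 1"
| "opuc \<alpha> (Suc n) = [:0, 1:] * opuc \<alpha> n - smult (cnj (\<alpha> n)) (szego_star n (opuc \<alpha> n))"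

text \<open>The paraorthogonal polynomial of degree \<open>n + 1\<close> with parameter b on the unit circle.\<close>
definition popuc :: "(nat \<Rightarrow> complex) \<Rightarrow> complex \<Rightarrow> nat \<Rightarrow> complex poly" where
  "popuc \<alpha> b n = [:0, 1:] * opuc \<alpha> n - smult (cnj b) (szego_star n (opuc \<alpha> n))"

text \<open>
  The quotient of the reals by \<open>2 * pi\<close> is represented by the unit circle in the complex plane,
  with \<open>cis\<close> as the quotient map.
\<close>
definition circle_borel :: "complex measure" where
  "circle_borel = restrict_space borel (sphere 0 1)"

definition zero_angles :: "(nat \<Rightarrow> complex) \<Rightarrow> (nat \<Rightarrow> complex) \<Rightarrow> nat \<Rightarrow> real set" where
  "zero_angles \<alpha> \<beta> n =
     {\<theta>. 0 \<le> \<theta> \<and> \<theta> < 2 * pi \<and> poly (popuc \<alpha> (\<beta> (n - 1)) (n - 1)) (cis \<theta>) = 0}"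

text \<open>
  Mass \<open>1 / n\<close> at each angle, transported to the circle. Counting angles without multiplicity is
  correct because all n zeros lie on the circle and are simple. Meaningful for \<open>n \<ge> 1\<close> only.
\<close>
definition zero_measure :: "(nat \<Rightarrow> complex) \<Rightarrow> (nat \<Rightarrow> complex) \<Rightarrow> nat \<Rightarrow> complex measure" where
  "zero_measure \<alpha> \<beta> n =
     distr (point_measure (zero_angles \<alpha> \<beta> n) (\<lambda>_. ennreal (1 / real n))) circle_borel cis"

definition weak_star_limit :: "(nat \<Rightarrow> complex measure) \<Rightarrow> complex measure \<Rightarrow> bool" where
  "weak_star_limit \<mu> \<nu> \<longleftrightarrow>
     (\<forall>f :: complex \<Rightarrow> real. continuous_on (sphere 0 1) f \<longrightarrow>
        (\<lambda>k. integral\<^sup>L (\<mu> k) f) \<longlonglongrightarrow> integral\<^sup>L \<nu> f)"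

lemma coeff_szego_star: "coeff (szego_star n p) k = (if k \<le> n then cnj (coeff p (n - k)) else 0)"
  by (simp add: szego_star_def coeff_sum if_distrib cong: if_cong)

lemma degree_szego_star: "degree (szego_star n p) \<le> n"
  by (rule degree_le) (simp add: coeff_szego_star)

lemma degree_opuc: "degree (opuc \<alpha> n) \<le> n"
proof (induction n)
  case (Suc n)
  then show ?case
    using degree_szego_star[of n "opuc \<alpha> n"] degree_smult_le[of "cnj (\<alpha> n)" "szego_star n (opuc \<alpha> n)"]
    by (auto intro!: degree_diff_le)
qed simp

lemma poly_szego_star:
  assumes "degree p \<le> n" "z \<noteq> 0"
  shows "poly (szego_star n p) z = z ^ n * cnj (poly p (1 / cnj z))"
proof -
  have "poly (szego_star n p) z = (\<Sum>k\<le>n. cnj (coeff p (n - k)) * z ^ k)"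
    by (simp add: szego_star_def poly_sum poly_monom)
  also have "\<dots> = (\<Sum>k\<le>n. cnj (coeff p k) * z ^ (n - k))"
    by (rule sum.reindex_bij_witness[of _ "\<lambda>k. n - k" "\<lambda>k. n - k"]) auto
  also have "\<dots> = (\<Sum>k\<le>n. z ^ n * cnj (coeff p k * (1 / cnj z) ^ k))"
    using assms(2) by (intro sum.cong) (auto simp: power_diff power_divide)
  also have "\<dots> = z ^ n * cnj (poly p (1 / cnj z))"
    by (subst poly_as_sum_of_monoms'[OF assms(1), symmetric])
       (simp add: poly_sum poly_monom sum_distrib_left)
  finally show ?thesis .
qed

end

theory Submission
  imports Defs
begin

text \<open>
  On the unit circle the quotient of \<open>z \<Phi>\<^sub>n\<close> by \<open>\<Phi>\<^sub>n\<^sup>*\<close> has modulus 1, and the Szego recursion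
  gives an explicit continuous branch of its argument along \<open>z = cis t\<close>: a Pruefer phase that
  increases in t and gains t plus an error of at most \<open>pi * \<bar>\<alpha>\<^sub>n\<bar>\<close> at step n. Zeros of the
  paraorthogonal polynomial are the t at which the phase hits a fixed value modulo \<open>2 * pi\<close>, so
  an arc of length \<open>\<Delta>\<close> holds at most \<open>n * \<Delta> / (2 * pi) + (\<Sum>k<n. \<bar>\<alpha>\<^sub>k\<bar>) + 1\<close> of
  them. In the limit this bounds the measure of every closed arc from above, and the lower bound
  follows by passing to the complementary arc, because the limit is a probability measure.
\<close>

section \<open>The circle as a quotient of the line\<close>

lemma cis_eq_cis_iff: "cis x = cis y \<longleftrightarrow> (\<exists>m::int. x = y + 2 * pi * m)"
  using sin_cos_eq_iff[of x y] by (auto simp: complex_eq_iff)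

lemma cis_inject:
  assumes "cis x = cis y" "\<bar>x - y\<bar> < 2 * pi"
  shows "x = y"
proof -
  obtain m :: int where m: "x = y + 2 * pi * m" using assms(1) by (auto simp: cis_eq_cis_iff)
  with assms(2) have "\<bar>real_of_int m\<bar> < 1" by (simp add: abs_mult)
  then show ?thesis using m by simp
qed

lemma inj_on_cis: "inj_on cis {a..<a + 2 * pi}"
  by (rule inj_onI) (erule cis_inject, auto simp: abs_less_iff)

lemma sphere_eq_cis_image: "sphere 0 1 = cis ` {a..<a + 2 * pi}"
proof (intro equalityI subsetI)
  fix z :: complex assume "z \<in> sphere 0 1"
  then have "z \<noteq> 0" "cmod z = 1" by auto
  then have z: "z = cis (Arg z)" by (simp add: cis_Arg sgn_eq)
  define m where "m = \<lfloor>(Arg z - a) / (2 * pi)\<rfloor>"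
  define x where "x = Arg z - 2 * pi * m"
  have "m \<le> (Arg z - a) / (2 * pi)" "(Arg z - a) / (2 * pi) < m + 1"
    unfolding m_def by linarith+
  then have "x \<in> {a..<a + 2 * pi}"
    by (auto simp: x_def field_simps)
  moreover have "cis (Arg z) = cis x"
    unfolding cis_eq_cis_iff x_def by (intro exI[of _ m]) simp
  ultimately show "z \<in> cis ` {a..<a + 2 * pi}" using z by auto
qed auto

section \<open>Size of the argument of \<open>1 - u\<close> in the unit disk\<close>

text \<open>Jordan's inequality: sine is concave here, so its graph lies above the chord from 0 to
  \<open>pi / 2\<close>.\<close>

lemma sin_ge_linear:
  assumes "0 \<le> x" "x \<le> pi / 2"
  shows "2 / pi * x \<le> sin x"
proof -
  have "convex_on {0..pi / 2} (\<lambda>x. - sin x)"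
    by (rule convex_on_realI[where f' = "\<lambda>x. - cos x"])
       (auto intro!: derivative_eq_intros simp: cos_mono_le_eq)
  \<comment> \<open>The weight \<open>2 / pi * x\<close> writes x as a convex combination of the
    endpoints 0 and \<open>pi / 2\<close>.\<close>
  from convex_onD[OF this, of "2 / pi * x" 0 "pi / 2"] show ?thesis
    using assms by (simp add: field_simps)
qed

lemma abs_le_abs_sin:
  assumes "\<bar>x\<bar> \<le> pi / 2"
  shows "\<bar>x\<bar> \<le> pi / 2 * \<bar>sin x\<bar>"
proof -
  have "2 / pi * \<bar>x\<bar> \<le> sin \<bar>x\<bar>" using assms by (intro sin_ge_linear) auto
  also have "\<dots> \<le> \<bar>sin x\<bar>" by (cases "x \<ge> 0") auto
  finally show ?thesis by (simp add: field_simps)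
qed

text \<open>The point \<open>1 - u\<close> lies in the right half plane, so its argument is at most
  \<open>pi / 2\<close> in absolute value and is controlled by its sine, which is at most
  \<open>cmod u\<close> in absolute value.\<close>

lemma abs_Im_Ln_le:
  assumes "cmod u < 1"
  shows "\<bar>Im (Ln (1 - u))\<bar> \<le> pi / 2 * cmod u"
proof -
  define w where "w = 1 - u"
  have re: "Re w > 0" using assms complex_Re_le_cmod[of u] by (simp add: w_def)
  then have w0: "w \<noteq> 0" by auto
  have A: "Im (Ln w) = Arg w" using w0 by (simp add: Arg_def)
  \<comment> \<open>The product is w minus the real number \<open>(cmod w)\<^sup>2\<close>; its
    modulus brings in the factor \<open>cmod w\<close> that cancels in the sine of the
    argument.\<close>
  have "Im w = Im (w * cnj (1 - w))" by (simp add: algebra_simps)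
  then have "\<bar>Im w\<bar> \<le> cmod (w * cnj (1 - w))" by (metis abs_Im_le_cmod)
  also have "\<dots> = cmod w * cmod u" by (simp add: norm_mult w_def del: complex_cnj_diff)
  finally have "\<bar>sin (Arg w)\<bar> \<le> cmod u"
    using w0 by (simp add: sin_Arg field_simps)
  moreover have "\<bar>Arg w\<bar> \<le> pi / 2 * \<bar>sin (Arg w)\<bar>"
    using Re_Ln_pos_lt_imp[OF re] A by (intro abs_le_abs_sin) auto
  moreover have "pi / 2 * \<bar>sin (Arg w)\<bar> \<le> pi / 2 * cmod u"
    using \<open>\<bar>sin (Arg w)\<bar> \<le> cmod u\<close> by (intro mult_left_mono) auto
  ultimately show ?thesis using A unfolding w_def by linarith
qed

section \<open>The phase change in one recursion step\<close>

text \<open>For \<open>cmod a < 1\<close> this lifts to the line the action on the circle of the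
  disk automorphism sending e to \<open>(e - cnj a) / (1 - a * e)\<close>. The principal logarithm
  is smooth along the way because \<open>1 - a * cis x\<close> has positive real part.\<close>

definition szego_phase :: "complex \<Rightarrow> real \<Rightarrow> real" where
  "szego_phase a x = x - 2 * Im (Ln (1 - a * cis x))"

text \<open>With \<open>w = 1 - a * cis x\<close>, rotation by minus twice the argument of w turns w
  into \<open>cnj w\<close>, and \<open>cis x * cnj w\<close> is
  \<open>cis x - cnj a\<close>.\<close>

lemma cis_szego_phase:
  assumes "cmod a < 1"
  shows "cis (szego_phase a x) * (1 - a * cis x) = cis x - cnj a"
proof -
  define w where "w = 1 - a * cis x"
  have w0: "w \<noteq> 0"
    using assms by (auto simp: w_def norm_mult dest: arg_cong[of _ _ cmod])
  define \<rho> \<phi> where "\<rho> = cmod w" and "\<phi> = Im (Ln w)"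
  have w: "of_real \<rho> * cis \<phi> = w"
    using rcis_cmod_Arg[of w] w0 by (simp add: rcis_def \<rho>_def \<phi>_def Arg_def)
  have "cis (- 2 * \<phi>) * (of_real \<rho> * cis \<phi>) = cnj (of_real \<rho> * cis \<phi>)"
    by (simp add: mult.left_commute cis_mult cis_cnj)
  then have "cis (- 2 * \<phi>) * w = cnj w" by (simp only: w)
  then have "cis (szego_phase a x) * w = cis x * cnj w"
    using cis_mult[of x "- 2 * \<phi>", symmetric]
    by (simp add: szego_phase_def mult.assoc \<phi>_def flip: w_def)
  also have "\<dots> = cis x - cnj a"
    by (simp add: w_def algebra_simps flip: cis_cnj) (simp add: cis_cnj cis_mult)
  finally show ?thesis by (simp add: w_def)
qed

lemma szego_phase_bound:
  assumes "cmod a < 1"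
  shows "\<bar>szego_phase a x - x\<bar> \<le> pi * cmod a"
  using abs_Im_Ln_le[of "a * cis x"] assms by (simp add: szego_phase_def norm_mult)

text \<open>A disk automorphism preserves the orientation of the circle; for the lift this is
  positivity of the derivative.\<close>

lemma strict_mono_szego_phase:
  assumes "cmod a < 1"
  shows "strict_mono (szego_phase a)"
proof (rule strict_monoI)
  fix x y :: real assume "x < y"
  then show "szego_phase a x < szego_phase a y"
  proof (rule DERIV_pos_imp_increasing)
    fix t :: real
    define u where "u = a * cis t"
    have u: "cmod u < 1" using assms by (simp add: u_def norm_mult)
    then have re: "Re (1 - u) > 0" using complex_Re_le_cmod[of u] by simp
    then have u1: "1 - u \<noteq> 0" by auto
    \<comment> \<open>The logarithm is differentiated in a complex variable first, then restricted
      to the real axis.\<close>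
    have "((\<lambda>z. Ln (1 - a * exp (\<i> * z))) has_field_derivative - (\<i> * u) / (1 - u)) (at (of_real t))"
      using re u1 by (auto intro!: derivative_eq_intros simp: u_def cis_conv_exp complex_nonpos_Reals_iff divide_inverse mult_ac)
    from has_vector_derivative_real_field[OF this]
    have "((\<lambda>s. Ln (1 - a * cis s)) has_vector_derivative - (\<i> * u) / (1 - u)) (at t)"
      by (simp add: cis_conv_exp)
    from bounded_linear.has_vector_derivative[OF bounded_linear_Im this]
    have "((\<lambda>s. Im (Ln (1 - a * cis s))) has_real_derivative Im (- (\<i> * u) / (1 - u))) (at t)"
      by (simp add: has_real_derivative_iff_has_vector_derivative)
    then have "(szego_phase a has_real_derivative 1 - 2 * Im (- (\<i> * u) / (1 - u))) (at t)"
      unfolding szego_phase_def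
      by (intro DERIV_diff DERIV_ident DERIV_cmult)
    moreover have "1 - 2 * Im (- (\<i> * u) / (1 - u)) > 0"
    proof -
      \<comment> \<open>the derivative is the Poisson kernel\<close>
      have "1 - 2 * Im (- (\<i> * u) / (1 - u)) = Re (1 + 2 * (u / (1 - u)))"
        by (simp add: Re_divide Im_divide)
      also have "1 + 2 * (u / (1 - u)) = (1 + u) / (1 - u)"
        using u1 by (simp add: field_simps)
      also have "Re \<dots> = (1 - (cmod u)\<^sup>2) / (cmod (1 - u))\<^sup>2"
        by (simp add: Re_divide' cmod_power2) (simp add: algebra_simps power2_eq_square)
      also have "\<dots> > 0" using u u1 by (simp add: abs_square_less_1)
      finally show ?thesis .
    qed
    ultimately show "\<exists>d. (szego_phase a has_real_derivative d) (at t) \<and> 0 < d" by blast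
  qed
qed

section \<open>The Pruefer phase and the zeros\<close>

text \<open>A branch of the argument of \<open>z \<Phi>\<^sub>n / \<Phi>\<^sub>n\<^sup>*\<close> at \<open>z = cis t\<close>.\<close>
primrec prufer :: "(nat \<Rightarrow> complex) \<Rightarrow> nat \<Rightarrow> real \<Rightarrow> real" where
  "prufer \<alpha> 0 t = t"
| "prufer \<alpha> (Suc n) t = t + szego_phase (\<alpha> n) (prufer \<alpha> n t)"

lemma strict_mono_prufer:
  assumes "\<And>n. cmod (\<alpha> n) < 1"
  shows "strict_mono (prufer \<alpha> n)"
proof (induction n)
  case (Suc n)
  show ?case
  proof (rule strict_monoI)
    fix x y :: real assume "x < y"
    then have "prufer \<alpha> n x < prufer \<alpha> n y" by (rule strict_monoD[OF Suc])
    then have "szego_phase (\<alpha> n) (prufer \<alpha> n x) < szego_phase (\<alpha> n) (prufer \<alpha> n y)"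
      by (rule strict_monoD[OF strict_mono_szego_phase[OF assms]])
    with \<open>x < y\<close> show "prufer \<alpha> (Suc n) x < prufer \<alpha> (Suc n) y" by simp
  qed
qed (simp add: strict_mono_def)

text \<open>The errors of the single steps add up. The main term has the factor \<open>Suc n\<close>
  because the phase at index 0 is already t.\<close>

lemma prufer_bound:
  assumes "\<And>n. cmod (\<alpha> n) < 1"
  shows "\<bar>prufer \<alpha> n t - real (Suc n) * t\<bar> \<le> pi * (\<Sum>k<n. cmod (\<alpha> k))"
proof (induction n)
  case (Suc n)
  then show ?case
    using szego_phase_bound[OF assms, of n "prufer \<alpha> n t"] by (simp add: algebra_simps)
qed simp

lemma poly_szego_star_circle:
  assumes "degree p \<le> n" "cmod z = 1"
  shows "poly (szego_star n p) z = z ^ n * cnj (poly p z)"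
proof -
  have "z \<noteq> 0" using assms(2) by auto
  moreover from this have "1 / cnj z = z"
    using assms(2) complex_norm_square[of z] by (simp add: field_simps)
  ultimately show ?thesis using poly_szego_star[OF assms(1), of z] by simp
qed

text \<open>If e is the quotient at index n, the recursion multiplies the reversed polynomial by
  \<open>1 - \<alpha> n * e\<close> and makes the next polynomial
  \<open>e - cnj (\<alpha> n)\<close> times the old reversed one. The new quotient is thus z times
  the automorphism that \<open>szego_phase\<close> lifts. Nonvanishing is carried along so that
  quotients make sense.\<close>

lemma opuc_prufer:
  fixes \<alpha> :: "nat \<Rightarrow> complex" and t :: real
  assumes "\<And>n. cmod (\<alpha> n) < 1"
  defines "z \<equiv> cis t"
  shows "poly (szego_star n (opuc \<alpha> n)) z \<noteq> 0 \<and>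
    z * poly (opuc \<alpha> n) z = cis (prufer \<alpha> n t) * poly (szego_star n (opuc \<alpha> n)) z"
proof (induction n)
  case 0
  then show ?case
    by (simp add: z_def szego_star_def poly_monom)
next
  case (Suc n)
  define A where "A = z * poly (opuc \<alpha> n) z"
  define B where "B = poly (szego_star n (opuc \<alpha> n)) z"
  define e where "e = cis (prufer \<alpha> n t)"
  have zz: "z * cnj z = 1" by (simp add: z_def cis_cnj cis_mult)
  have B: "B = z ^ n * cnj (poly (opuc \<alpha> n) z)"
    unfolding B_def by (rule poly_szego_star_circle[OF degree_opuc]) (simp add: z_def)
  have A': "A = e * B" "B \<noteq> 0" using Suc by (auto simp: A_def B_def e_def)
  have next1: "poly (opuc \<alpha> (Suc n)) z = (e - cnj (\<alpha> n)) * B"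
    using A' by (simp add: A_def B_def algebra_simps)
  \<comment> \<open>The recursion for the reversed polynomial comes from conjugating the given one
    on the circle, where \<open>z * cnj z = 1\<close>.\<close>
  have "poly (szego_star (Suc n) (opuc \<alpha> (Suc n))) z = z ^ Suc n * cnj (poly (opuc \<alpha> (Suc n)) z)"
    by (rule poly_szego_star_circle[OF degree_opuc]) (simp add: z_def)
  also have "\<dots> = z ^ Suc n * cnj (A - cnj (\<alpha> n) * B)"
    by (simp add: A_def B_def)
  also have "\<dots> = (z * cnj z) * B - \<alpha> n * z * ((z * cnj z) ^ n * poly (opuc \<alpha> n) z)"
    by (simp add: A_def B power_mult_distrib) (simp add: algebra_simps)
  also have "\<dots> = (1 - \<alpha> n * e) * B"
    using A' by (simp add: zz A_def algebra_simps)
  finally have next2: "poly (szego_star (Suc n) (opuc \<alpha> (Suc n))) z = (1 - \<alpha> n * e) * B" .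
  have "1 - \<alpha> n * e \<noteq> 0"
    using assms(1)[of n] by (auto simp: e_def norm_mult dest: arg_cong[of _ _ cmod])
  moreover have "cis (prufer \<alpha> (Suc n) t) * (1 - \<alpha> n * e) = z * (e - cnj (\<alpha> n))"
    using cis_szego_phase[OF assms(1), of n "prufer \<alpha> n t"]
    by (simp add: z_def e_def mult.assoc flip: cis_mult)
  ultimately show ?case
    unfolding next1 next2 mult.assoc[symmetric] using A'(2) by simp
qed

text \<open>The value factors as \<open>cis (prufer \<alpha> n t) - cnj b\<close> times the nonzero
  value of the reversed polynomial.\<close>

lemma poly_popuc_eq_0_iff:
  assumes "\<And>n. cmod (\<alpha> n) < 1"
  shows "poly (popuc \<alpha> b n) (cis t) = 0 \<longleftrightarrow> cis (prufer \<alpha> n t) = cnj b"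
  using opuc_prufer[of \<alpha> n t, OF assms] by (simp add: popuc_def)

section \<open>Counting zeros in an arc\<close>

text \<open>An increasing f meets each level \<open>c + 2 * pi * m\<close> at most once, so it
  suffices to count the integers m with \<open>x \<le> m < y\<close>, of which there are fewer than
  \<open>y - x + 1\<close>.\<close>

lemma card_phase_level:
  fixes f :: "real \<Rightarrow> real" and c :: real
  assumes "strict_mono f" "a \<le> b"
  defines "S \<equiv> {t \<in> {a..<b}. cis (f t) = cis c}"
  shows "finite S" "real (card S) \<le> (f b - f a) / (2 * pi) + 1"
proof -
  define x y where "x = (f a - c) / (2 * pi)" and "y = (f b - c) / (2 * pi)"
  \<comment> \<open>On \<open>S\<close> the quotient is an integer, so the floor is exact and
    returns the index of the level.\<close>
  define g where "g t = \<lfloor>(f t - c) / (2 * pi)\<rfloor>" for t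
  have g: "(f t - c) / (2 * pi) = g t" if "t \<in> S" for t
  proof -
    from that obtain m :: int where "f t = c + 2 * pi * m" by (auto simp: S_def cis_eq_cis_iff)
    then have "(f t - c) / (2 * pi) = m" by simp
    then show ?thesis by (simp add: g_def)
  qed
  have inj: "inj_on g S"
  proof (rule inj_onI)
    fix t u assume tu: "t \<in> S" "u \<in> S" "g t = g u"
    then have "(f t - c) / (2 * pi) = (f u - c) / (2 * pi)" by (simp only: g)
    then have "f t = f u" by simp
    then show "t = u" using assms(1) by (simp add: strict_mono_eq)
  qed
  have sub: "g ` S \<subseteq> {\<lceil>x\<rceil>..<\<lceil>y\<rceil>}"
  proof clarify
    fix t assume t: "t \<in> S"
    then have "a \<le> t" "t < b" by (auto simp: S_def)
    then have "f a \<le> f t" "f t < f b"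
      using assms(1) by (auto simp: strict_mono_less_eq strict_mono_less)
    then have "x \<le> g t" "g t < y" unfolding g[OF t, symmetric] x_def y_def
      by (auto intro!: divide_right_mono divide_strict_right_mono)
    then show "g t \<in> {\<lceil>x\<rceil>..<\<lceil>y\<rceil>}" by (auto simp: ceiling_le_iff less_ceiling_iff)
  qed
  show "finite S" using finite_subset[OF sub] inj by (auto dest: finite_imageD)
  have "f a \<le> f b" using assms(1,2) by (simp add: strict_mono_less_eq)
  then have "x \<le> y" by (auto simp: x_def y_def intro!: divide_right_mono)
  have "card S \<le> nat (\<lceil>y\<rceil> - \<lceil>x\<rceil>)"
    using card_inj_on_le[OF inj sub] by simp
  moreover have "\<lceil>x\<rceil> \<le> \<lceil>y\<rceil>" using \<open>x \<le> y\<close> by (rule ceiling_mono)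
  ultimately have "real (card S) \<le> real_of_int (\<lceil>y\<rceil> - \<lceil>x\<rceil>)" by linarith
  also have "\<dots> \<le> y - x + 1" by linarith
  also have "y - x = (f b - f a) / (2 * pi)"
    by (simp add: x_def y_def diff_divide_distrib)
  finally show "real (card S) \<le> (f b - f a) / (2 * pi) + 1" .
qed

text \<open>The phase error enters at both endpoints, each time with the factor pi; division by
  \<open>2 * pi\<close> leaves the sum with coefficient 1. The final 1 comes from counting
  integers.\<close>

lemma card_popuc_zeros_le:
  fixes \<alpha> :: "nat \<Rightarrow> complex" and n :: nat
  assumes "\<And>n. cmod (\<alpha> n) < 1" "cmod b = 1" "u \<le> v"
  defines "S \<equiv> {t \<in> {u..<v}. poly (popuc \<alpha> b n) (cis t) = 0}"
  shows "finite S"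
    and "real (card S) \<le> real (Suc n) * (v - u) / (2 * pi) + (\<Sum>k<n. cmod (\<alpha> k)) + 1"
proof -
  have "cnj b = cis (Arg (cnj b))"
    using assms(2) by (subst cis_Arg) (auto simp: sgn_eq)
  then have S: "S = {t \<in> {u..<v}. cis (prufer \<alpha> n t) = cis (Arg (cnj b))}"
    unfolding S_def poly_popuc_eq_0_iff[of \<alpha>, OF assms(1)] by simp
  show "finite S" unfolding S
    by (rule card_phase_level(1)[OF strict_mono_prufer[of \<alpha>, OF assms(1)] assms(3)])
  have "prufer \<alpha> n v - prufer \<alpha> n u \<le> real (Suc n) * (v - u) + 2 * pi * (\<Sum>k<n. cmod (\<alpha> k))"
    using prufer_bound[of \<alpha> n u, OF assms(1)] prufer_bound[of \<alpha> n v, OF assms(1)]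
    by (simp add: algebra_simps)
  then have "(prufer \<alpha> n v - prufer \<alpha> n u) / (2 * pi) \<le>
      (real (Suc n) * (v - u) + 2 * pi * (\<Sum>k<n. cmod (\<alpha> k))) / (2 * pi)"
    by (rule divide_right_mono) simp
  also have "\<dots> = real (Suc n) * (v - u) / (2 * pi) + (\<Sum>k<n. cmod (\<alpha> k))"
    by (simp add: add_divide_distrib)
  finally show "real (card S) \<le> real (Suc n) * (v - u) / (2 * pi) + (\<Sum>k<n. cmod (\<alpha> k)) + 1"
    using card_phase_level(2)[OF strict_mono_prufer[of \<alpha> n, OF assms(1)] assms(3)]
    unfolding S by (meson add_right_mono order_trans)
qed

section \<open>Integrals against the zero measures\<close>

lemma integral_zero_measure:
  fixes f :: "complex \<Rightarrow> real"
  assumes "finite (zero_angles \<alpha> \<beta> n)" "continuous_on (sphere 0 1) f"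
  shows "integral\<^sup>L (zero_measure \<alpha> \<beta> n) f = (\<Sum>t\<in>zero_angles \<alpha> \<beta> n. f (cis t)) / n"
proof -
  have "f \<in> borel_measurable circle_borel"
    unfolding circle_borel_def by (rule borel_measurable_continuous_on_restrict[OF assms(2)])
  moreover have "cis \<in> measurable (point_measure (zero_angles \<alpha> \<beta> n) (\<lambda>_. ennreal (1 / real n))) circle_borel"
    by (auto simp: circle_borel_def space_restrict_space)
  ultimately show ?thesis
    unfolding zero_measure_def
    by (simp add: integral_distr lebesgue_integral_point_measure_finite[OF assms(1)] sum_divide_distrib)
qed

text \<open>On the circle f lies below the indicator of the arc, so its integral is at most the
  fraction of zeros in the arc. Continuous test functions are used because weak limits are tested on
  them.\<close>

lemma integral_zero_measure_le:
  fixes f :: "complex \<Rightarrow> real"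
  assumes \<alpha>: "\<And>n. cmod (\<alpha> n) < 1" and \<beta>: "\<And>n. \<beta> n \<in> sphere 0 1" and n: "n > 0"
    and f: "continuous_on (sphere 0 1) f" "\<And>z. z \<in> sphere 0 1 \<Longrightarrow> f z \<le> 1"
      "\<And>z. z \<in> sphere 0 1 \<Longrightarrow> z \<notin> cis ` {u..<v} \<Longrightarrow> f z \<le> 0"
    and uv: "u \<le> v" "v \<le> u + 2 * pi"
  shows "integral\<^sup>L (zero_measure \<alpha> \<beta> n) f \<le> (v - u) / (2 * pi) + 1 / n * (\<Sum>k<n. cmod (\<alpha> k)) + 1 / n"
proof -
  define P where "P = popuc \<alpha> (\<beta> (n - 1)) (n - 1)"
  have \<beta>1: "cmod (\<beta> (n - 1)) = 1" using \<beta>[of "n - 1"] by simp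
  have Z: "zero_angles \<alpha> \<beta> n = {t \<in> {0..<2 * pi}. poly P (cis t) = 0}"
    by (auto simp: zero_angles_def P_def)
  have fin: "finite (zero_angles \<alpha> \<beta> n)"
    unfolding Z P_def by (rule card_popuc_zeros_le(1)[of \<alpha>, OF \<alpha> \<beta>1]) simp
  define S where "S = {t \<in> {u..<v}. poly P (cis t) = 0}"
  have S: "finite S" "real (card S) \<le> real (Suc (n - 1)) * (v - u) / (2 * pi) + (\<Sum>k<n-1. cmod (\<alpha> k)) + 1"
    unfolding S_def P_def by (rule card_popuc_zeros_le[of \<alpha>, OF \<alpha> \<beta>1 uv(1)])+
  \<comment> \<open>The interval from u to v may leave the window from 0 to \<open>2 * pi\<close>,
    so \<open>T\<close> and \<open>S\<close> may hold different representatives of the same zeros;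
    they are compared through their images on the circle.\<close>
  define T where "T = {t \<in> zero_angles \<alpha> \<beta> n. cis t \<in> cis ` {u..<v}}"
  have "inj_on cis T"
    using inj_on_cis[of 0] by (rule inj_on_subset) (auto simp: T_def Z)
  then have "card T = card (cis ` T)" by (simp add: card_image)
  also have "\<dots> \<le> card (cis ` S)"
    using S(1) by (intro card_mono) (auto simp: T_def S_def Z)
  also have "\<dots> \<le> card S" using S(1) by (rule card_image_le)
  finally have TS: "card T \<le> card S" .
  have "(\<Sum>t\<in>zero_angles \<alpha> \<beta> n. f (cis t)) \<le> (\<Sum>t\<in>zero_angles \<alpha> \<beta> n. if cis t \<in> cis ` {u..<v} then 1 else 0)"
    by (intro sum_mono) (auto intro: f(2,3))
  also have "\<dots> = real (card T)"
    using fin by (simp add: sum.If_cases T_def Collect_conj_eq Int_commute)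
  also have "\<dots> \<le> real (card S)" using TS by simp
  also have "\<dots> \<le> n * (v - u) / (2 * pi) + (\<Sum>k<n. cmod (\<alpha> k)) + 1"
  proof -
    \<comment> \<open>The polynomial of degree n involves only the coefficients below
      \<open>n - 1\<close>, while the averages run over those below n.\<close>
    have "(\<Sum>k<n-1. cmod (\<alpha> k)) \<le> (\<Sum>k<n. cmod (\<alpha> k))" by (rule sum_mono2) auto
    then show ?thesis using S(2) n by simp
  qed
  finally have "(\<Sum>t\<in>zero_angles \<alpha> \<beta> n. f (cis t)) / n \<le> (n * (v - u) / (2 * pi) + (\<Sum>k<n. cmod (\<alpha> k)) + 1) / n"
    by (rule divide_right_mono) simp
  also have "\<dots> = (v - u) / (2 * pi) + 1 / n * (\<Sum>k<n. cmod (\<alpha> k)) + 1 / n"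
    using n by (simp add: add_divide_distrib)
  finally show ?thesis by (simp add: integral_zero_measure[OF fin f(1)])
qed

section \<open>Arcs: complements, measurability, cutoff functions\<close>

lemma compact_cis_image: "compact (cis ` {a..b})"
  by (intro compact_continuous_image continuous_intros) auto

text \<open>Going once around the circle from a, the points outside the open arc are those from b on
  to \<open>a + 2 * pi\<close>. This turns upper bounds for closed arcs into lower bounds for open
  ones.\<close>

lemma cis_open_arc:
  assumes "a < b" "b \<le> a + 2 * pi"
  shows "cis ` {a<..<b} = sphere 0 1 - cis ` {b..a + 2 * pi}"
proof (intro equalityI subsetI)
  fix z assume "z \<in> cis ` {a<..<b}"
  then obtain t where t: "z = cis t" "a < t" "t < b" by auto
  have "cis t \<noteq> cis s" if "s \<in> {b..a + 2 * pi}" for s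
    using cis_inject[of t s] t that by (auto simp: abs_less_iff)
  then have "z \<notin> cis ` {b..a + 2 * pi}" unfolding t(1) by blast
  then show "z \<in> sphere 0 1 - cis ` {b..a + 2 * pi}" using t by simp
next
  fix z assume z: "z \<in> sphere 0 1 - cis ` {b..a + 2 * pi}"
  then obtain t where t: "z = cis t" "a \<le> t" "t < a + 2 * pi"
    using sphere_eq_cis_image[of a] by auto
  \<comment> \<open>The starting point a is removed because it is also the far end of the closed
    arc.\<close>
  have "cis (a + 2 * pi) = cis a" by (simp flip: cis_mult)
  moreover have "cis (a + 2 * pi) \<in> cis ` {b..a + 2 * pi}" using assms by simp
  ultimately have "t \<noteq> a" using z t by auto
  moreover have "t < b" using z t by force
  ultimately show "z \<in> cis ` {a<..<b}" using t by auto
qed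

lemma closed_arc_sets: "cis ` {a..b} \<in> sets circle_borel"
  using compact_imp_closed[OF compact_cis_image[of a b]]
  by (auto simp: circle_borel_def sets_restrict_space_iff)

lemma open_arc_sets:
  assumes "a < b" "b \<le> a + 2 * pi"
  shows "cis ` {a<..<b} \<in> sets circle_borel"
proof -
  have "space circle_borel = sphere 0 1" by (simp add: circle_borel_def space_restrict_space)
  then show ?thesis
    unfolding cis_open_arc[OF assms] by (metis closed_arc_sets sets.compl_sets)
qed

lemma arc_sets:
  assumes "I \<in> {{a..b}, {a<..b}, {a..<b}, {a<..<b}}" "a < b" "b \<le> a + 2 * pi"
  shows "cis ` I \<in> sets circle_borel"
proof -
  have pt: "{cis t} \<in> sets circle_borel" for t
    using closed_arc_sets[of t t] by simp
  have "I = {a..b} \<or> I = insert b {a<..<b} \<or> I = insert a {a<..<b} \<or> I = {a<..<b}"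
    using assms(1,2) by auto
  then show ?thesis
    using open_arc_sets[OF assms(2,3)] sets.insert_in_sets[OF pt] closed_arc_sets by auto
qed

text \<open>Urysohn's lemma for the closed arc and the complement of its enlargement by \<epsilon>
  on both sides. The length condition keeps the enlarged arc from overlapping itself.\<close>

lemma arc_cutoff:
  assumes "a \<le> b" "\<epsilon> > 0" "b - a + 2 * \<epsilon> \<le> 2 * pi"
  obtains f :: "complex \<Rightarrow> real" where "continuous_on (sphere 0 1) f"
    "\<And>z. z \<in> sphere 0 1 \<Longrightarrow> 0 \<le> f z \<and> f z \<le> 1" "\<And>z. z \<in> cis ` {a..b} \<Longrightarrow> f z = 1"
    "\<And>z. z \<in> sphere 0 1 \<Longrightarrow> z \<notin> cis ` {a - \<epsilon><..<b + \<epsilon>} \<Longrightarrow> f z = 0"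
proof -
  define K L where "K = cis ` {a..b}" and "L = cis ` {b + \<epsilon>..(a - \<epsilon>) + 2 * pi}"
  have U: "cis ` {a - \<epsilon><..<b + \<epsilon>} = sphere 0 1 - L"
    unfolding L_def using assms by (intro cis_open_arc) auto
  have "K \<subseteq> cis ` {a - \<epsilon><..<b + \<epsilon>}" unfolding K_def using assms by (intro image_mono) auto
  then have disj: "K \<inter> L = {}" using U by auto
  have cl: "closedin (top_of_set (sphere 0 1)) K" "closedin (top_of_set (sphere 0 1)) L"
    unfolding K_def L_def
    by (intro closed_subset compact_imp_closed[OF compact_cis_image]; auto)+
  obtain f :: "complex \<Rightarrow> real" where f: "continuous_on (sphere 0 1) f"
    "\<And>z. z \<in> sphere 0 1 \<Longrightarrow> f z \<in> closed_segment 1 0"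
    "\<And>z. z \<in> K \<Longrightarrow> f z = 1" "\<And>z. z \<in> L \<Longrightarrow> f z = 0"
    by (rule Urysohn_local[OF cl disj, of "1 :: real" 0]) blast
  show ?thesis
  proof (rule that[of f])
    fix z :: complex assume "z \<in> sphere 0 1"
    with f(2)[OF this] show "0 \<le> f z \<and> f z \<le> 1" by (auto simp: closed_segment_eq_real_ivl)
  qed (use f U in \<open>auto simp: K_def\<close>)
qed

section \<open>Passage to the weak limit\<close>

text \<open>The indicator of the closed arc lies below a cutoff supported on a slightly larger arc;
  the bound for the cutoff survives the limit, and the enlargement is arbitrarily small. The strict
  inequality \<open>b < a + 2 * pi\<close> leaves room for it.\<close>

lemma weak_star_limit_closed_arc_le:
  assumes \<nu>: "prob_space \<nu>" "sets \<nu> = sets circle_borel"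
    and lim: "weak_star_limit \<mu> \<nu>" and c: "c \<longlonglongrightarrow> r"
    and bound: "\<And>k f u v. continuous_on (sphere 0 1) f \<Longrightarrow> (\<And>z. z \<in> sphere 0 1 \<Longrightarrow> f z \<le> 1) \<Longrightarrow>
      (\<And>z. z \<in> sphere 0 1 \<Longrightarrow> z \<notin> cis ` {u..<v} \<Longrightarrow> f z \<le> 0) \<Longrightarrow> u \<le> v \<Longrightarrow> v \<le> u + 2 * pi \<Longrightarrow>
      integral\<^sup>L (\<mu> k) f \<le> (v - u) / (2 * pi) + c k"
    and ab: "a \<le> b" "b < a + 2 * pi"
  shows "measure \<nu> (cis ` {a..b}) \<le> (b - a) / (2 * pi) + r"
proof (rule field_le_epsilon)
  fix e :: real assume "e > 0"
  interpret prob_space \<nu> by (rule \<nu>)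
  \<comment> \<open>Half of the remaining gap is the largest enlargement on each side that still
    fits on the circle.\<close>
  define \<epsilon> where "\<epsilon> = min e ((2 * pi - (b - a)) / 2)"
  have \<epsilon>: "\<epsilon> > 0" "\<epsilon> \<le> e" "b - a + 2 * \<epsilon> \<le> 2 * pi"
    using ab \<open>e > 0\<close> by (auto simp: \<epsilon>_def min_def field_simps)
  obtain f :: "complex \<Rightarrow> real" where f: "continuous_on (sphere 0 1) f"
    "\<And>z. z \<in> sphere 0 1 \<Longrightarrow> 0 \<le> f z \<and> f z \<le> 1" "\<And>z. z \<in> cis ` {a..b} \<Longrightarrow> f z = 1"
    "\<And>z. z \<in> sphere 0 1 \<Longrightarrow> z \<notin> cis ` {a - \<epsilon><..<b + \<epsilon>} \<Longrightarrow> f z = 0"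
    by (rule arc_cutoff[OF ab(1) \<epsilon>(1,3)]) blast
  have sp: "space \<nu> = sphere 0 1"
    using sets_eq_imp_space_eq[OF \<nu>(2)] by (simp add: circle_borel_def space_restrict_space)
  have K: "cis ` {a..b} \<in> sets \<nu>" unfolding \<nu>(2) by (rule closed_arc_sets)
  have "f \<in> borel_measurable \<nu>"
    using borel_measurable_continuous_on_restrict[OF f(1)] measurable_cong_sets[OF \<nu>(2) refl]
    unfolding circle_borel_def by blast
  then have int: "integrable \<nu> f"
    using f(2) sp by (intro integrable_const_bound[where B = 1]) auto
  have "measure \<nu> (cis ` {a..b}) = integral\<^sup>L \<nu> (indicator (cis ` {a..b}))"
    using K sets.sets_into_space[OF K] by (simp add: Int_absorb2)
  also have "\<dots> \<le> integral\<^sup>L \<nu> f"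
    using K int f(2,3) sp
    by (intro integral_mono integrable_real_indicator) (auto simp: indicator_def less_top[symmetric])
  also have "\<dots> \<le> ((b + \<epsilon>) - (a - \<epsilon>)) / (2 * pi) + r"
  proof (rule LIMSEQ_le)
    show "(\<lambda>k. integral\<^sup>L (\<mu> k) f) \<longlonglongrightarrow> integral\<^sup>L \<nu> f"
      using lim f(1) by (simp add: weak_star_limit_def)
    show "(\<lambda>k. ((b + \<epsilon>) - (a - \<epsilon>)) / (2 * pi) + c k) \<longlonglongrightarrow> ((b + \<epsilon>) - (a - \<epsilon>)) / (2 * pi) + r"
      by (intro tendsto_intros c)
    have "integral\<^sup>L (\<mu> k) f \<le> ((b + \<epsilon>) - (a - \<epsilon>)) / (2 * pi) + c k" for k
    proof (rule bound[OF f(1)])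
      fix z :: complex assume "z \<in> sphere 0 1" "z \<notin> cis ` {a - \<epsilon>..<b + \<epsilon>}"
      moreover from this(2) have "z \<notin> cis ` {a - \<epsilon><..<b + \<epsilon>}" by auto
      ultimately show "f z \<le> 0" using f(4)[of z] by simp
    qed (use f(2) ab \<epsilon> in auto)
    then show "\<exists>N. \<forall>k\<ge>N. integral\<^sup>L (\<mu> k) f \<le> ((b + \<epsilon>) - (a - \<epsilon>)) / (2 * pi) + c k" by blast
  qed
  also have "((b + \<epsilon>) - (a - \<epsilon>)) / (2 * pi) = (b - a) / (2 * pi) + \<epsilon> / pi"
    by (simp add: field_simps)
  also have "\<epsilon> / pi \<le> \<epsilon>" using \<epsilon>(1) pi_gt3 by (simp add: divide_le_eq)
  finally show "measure \<nu> (cis ` {a..b}) \<le> (b - a) / (2 * pi) + r + e" using \<epsilon>(2) by simp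
qed

theorem theorem3p1:
  fixes \<alpha> \<beta> :: "nat \<Rightarrow> complex" and r :: real and nn s :: "nat \<Rightarrow> nat"
    and \<nu> :: "complex measure"
  assumes "\<And>n. norm (\<alpha> n) < 1"
    and "\<And>n. \<beta> n \<in> sphere 0 1"
    and "mono nn" and "filterlim nn at_top sequentially" and "\<And>j. nn j > 0"
    and "0 \<le> r" and "r < 1"
    and "(\<lambda>j. 1 / real (nn j) * (\<Sum>k<nn j. norm (\<alpha> k))) \<longlonglongrightarrow> r"
    and "prob_space \<nu>" and "sets \<nu> = sets circle_borel"
    and "strict_mono s" and "weak_star_limit (\<lambda>k. zero_measure \<alpha> \<beta> (nn (s k))) \<nu>"
  shows "(\<forall>(a :: real) b \<Delta> I. I \<in> {{a..b}, {a<..b}, {a..<b}, {a<..<b}} \<longrightarrow> b - a = \<Delta> \<longrightarrow>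
            \<Delta> \<in> {0<..2 * pi} \<longrightarrow>
            measure \<nu> (cis ` I) \<in> {\<Delta> / (2 * pi) - r .. \<Delta> / (2 * pi) + r})
       \<and> (\<forall>(a :: real) b \<Delta> I. I \<in> {{a..b}, {a<..b}, {a..<b}, {a<..<b}} \<longrightarrow> b - a = \<Delta> \<longrightarrow>
            \<Delta> \<in> {2 * pi * r<..2 * pi} \<longrightarrow> 0 < measure \<nu> (cis ` I))"
proof -
  interpret prob_space \<nu> by (rule assms(9))
  have sp: "space \<nu> = sphere 0 1"
    using sets_eq_imp_space_eq[OF assms(10)] by (simp add: circle_borel_def space_restrict_space)
  \<comment> \<open>The average tends to r; the extra \<open>1 / n\<close> is the counting error and
    vanishes in the limit.\<close>
  define c where "c k = 1 / real (nn (s k)) * (\<Sum>k<nn (s k). norm (\<alpha> k)) + 1 / real (nn (s k))" for k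
  have s: "filterlim s at_top sequentially" by (rule filterlim_subseq[OF assms(11)])
  have "(\<lambda>j. 1 / real (nn j)) \<longlonglongrightarrow> 0"
    by (rule filterlim_compose[OF lim_1_over_n assms(4)])
  from filterlim_compose[OF tendsto_add[OF assms(8) this] s]
  have c: "c \<longlonglongrightarrow> r" by (simp add: c_def[abs_def])
  have closed: "measure \<nu> (cis ` {a..b}) \<le> (b - a) / (2 * pi) + r"
    if "a \<le> b" "b < a + 2 * pi" for a b
  proof (rule weak_star_limit_closed_arc_le[OF assms(9,10,12) c _ that])
    fix k and f :: "complex \<Rightarrow> real" and u v :: real
    assume "continuous_on (sphere 0 1) f" "\<And>z. z \<in> sphere 0 1 \<Longrightarrow> f z \<le> 1"
      "\<And>z. z \<in> sphere 0 1 \<Longrightarrow> z \<notin> cis ` {u..<v} \<Longrightarrow> f z \<le> 0" "u \<le> v" "v \<le> u + 2 * pi"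
    with assms(1,2,5) show "integral\<^sup>L (zero_measure \<alpha> \<beta> (nn (s k))) f \<le> (v - u) / (2 * pi) + c k"
      unfolding c_def add.assoc[symmetric] by (intro integral_zero_measure_le) auto
  qed
  have main: "(b - a) / (2 * pi) - r \<le> measure \<nu> (cis ` I) \<and> measure \<nu> (cis ` I) \<le> (b - a) / (2 * pi) + r"
    if I: "I \<in> {{a..b}, {a<..b}, {a..<b}, {a<..<b}}" and ab: "a < b" "b \<le> a + 2 * pi" for a b I
  proof
    \<comment> \<open>Lower bound: every type of interval contains the open arc, whose complement is
      a closed arc of length \<open>2 * pi - (b - a)\<close>, and the total mass is 1.\<close>
    have "cis ` {a<..<b} \<subseteq> cis ` I" using I by (intro image_mono) auto
    then have "measure \<nu> (cis ` {a<..<b}) \<le> measure \<nu> (cis ` I)"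
      using arc_sets[OF I ab] assms(10) by (intro finite_measure_mono) auto
    moreover have "measure \<nu> (cis ` {a<..<b}) = 1 - measure \<nu> (cis ` {b..a + 2 * pi})"
      unfolding cis_open_arc[OF ab] sp[symmetric]
      using closed_arc_sets assms(10) by (intro prob_compl) auto
    moreover have "measure \<nu> (cis ` {b..a + 2 * pi}) \<le> (a + 2 * pi - b) / (2 * pi) + r"
      using ab by (intro closed) auto
    moreover have "(a + 2 * pi - b) / (2 * pi) = 1 - (b - a) / (2 * pi)"
      by (simp add: field_simps)
    ultimately show "(b - a) / (2 * pi) - r \<le> measure \<nu> (cis ` I)" by linarith
    show "measure \<nu> (cis ` I) \<le> (b - a) / (2 * pi) + r"
    \<comment> \<open>The closed arc bound excludes full length; there the claim is that a
      probability is at most \<open>1 + r\<close>.\<close>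
    proof (cases "b = a + 2 * pi")
      case True
      then have "(b - a) / (2 * pi) = 1" by simp
      with prob_le_1[of "cis ` I"] assms(6) show ?thesis by linarith
    next
      case False
      have "cis ` I \<subseteq> cis ` {a..b}" using I by (intro image_mono) auto
      then have "measure \<nu> (cis ` I) \<le> measure \<nu> (cis ` {a..b})"
        using closed_arc_sets assms(10) by (intro finite_measure_mono) auto
      also have "\<dots> \<le> (b - a) / (2 * pi) + r" using ab False by (intro closed) auto
      finally show ?thesis .
    qed
  qed
  show ?thesis
  proof (intro conjI allI impI)
    fix a b \<Delta> :: real and I
    assume "I \<in> {{a..b}, {a<..b}, {a..<b}, {a<..<b}}" "b - a = \<Delta>" "\<Delta> \<in> {0<..2 * pi}"
    then show "measure \<nu> (cis ` I) \<in> {\<Delta> / (2 * pi) - r .. \<Delta> / (2 * pi) + r}"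
      using main[of I a b] by auto
  next
    fix a b \<Delta> :: real and I
    assume *: "I \<in> {{a..b}, {a<..b}, {a..<b}, {a<..<b}}" "b - a = \<Delta>" "\<Delta> \<in> {2 * pi * r<..2 * pi}"
    then have "r < \<Delta> / (2 * pi)" by (simp add: field_simps)
    moreover have "0 < \<Delta>" using * assms(6) 
      by (auto intro: le_less_trans[rotated])
    ultimately show "0 < measure \<nu> (cis ` I)"
      using main[of I a b] * by auto
  qed
qed

end
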